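(* Let $h$ and $h_{\sharp}$ be $\mathbb{C}^{d\times d}$-valued functions whose entries are rational functions of $z$ with no poles in $\overline{\mathbb{D}}$, such that $\det h(z)$ and $\det h_\sharp(z)$ have no zeros in $\overline{\mathbb{D}}$, and such that $$h(e^{i\theta})h(e^{i\theta})^*=h_{\sharp}(e^{i\theta})^*h_{\sharp}(e^{i\theta}),\qquad \theta\in[-\pi,\pi).$$ Write $h^{-1}$ in the form $$h(z)^{-1} = - \rho_0 - \sum_{\mu=1}^{K} \sum_{j=1}^{m_{\mu}} \frac{1}{(1-\overline{p}_{\mu}z)^j}\rho_{\mu, j} - \sum_{j=1}^{m_0} z^j \rho_{0,j},$$ where $K\in\mathbb{N}\cup\{0\}$; $p_1,\dots,p_K\in\mathbb{D}\setminus\{0\}$ are distinct; $m_\mu\in\mathbb{N}$ for $\mu\in\{1,\dots,K\}$ and $m_0\in\mathbb{N}\cup\{0\}$; $\rho_0,\rho_{\mu,j}\in\mathbb{C}^{d\times d}$; and $\rho_{\mu,m_\mu}\neq 0$ for $\mu\in\{0,\dots,K\}$ (for $\mu=0$ this is required only if $m_0\ge 1$). Then, with the same $K$, $m_0$ and $(p_1,m_1),\dots,(p_K,m_K)$, $h_\sharp^{-1}$ has the form $$h_{\sharp}(z)^{-1} = - \rho_0^{\sharp} - \sum_{\mu=1}^{K} \sum_{j=1}^{m_{\mu}} \frac{1}{(1-\overline{p}_{\mu}z)^j}\rho_{\mu, j}^{\sharp} - \sum_{j=1}^{m_0} z^j \rho_{0,j}^{\sharp},$$ where $\rho_0^\sharp,\rho_{\mu,j}^\sharp\in\mathbb{C}^{d\times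 d}$ and $\rho_{\mu,m_\mu}^\sharp\ne 0$ for $\mu\in\{0,\dots,K\}$ (for $\mu=0$ only if $m_0\ge1$). Moreover, with $p_0:=0$, $$\rho_{\mu,m_{\mu}}\, h_{\sharp}(p_{\mu})^* = h(p_{\mu})^* \rho_{\mu,m_{\mu}}^{\sharp},\qquad \mu\in\{0,\dots,K\}$$ (for $\mu=0$ only if $m_0\ge 1$).
   Context: $d\in\mathbb{N}=\{1,2,\dots\}$; $\mathbb{D}=\{z\in\mathbb{C}:|z|<1\}$, $\overline{\mathbb{D}}=\{z\in\mathbb{C}:|z|\le 1\}$. For a complex matrix $a$, $a^*$ is the conjugate transpose; $\overline{p}$ is the complex conjugate. Empty sums are $0$. The common function $w(e^{i\theta})=h(e^{i\theta})h(e^{i\theta})^*=h_\sharp(e^{i\theta})^*h_\sharp(e^{i\theta})$ is the spectral density of a $d$-variate ARMA process $\{X_k\}$ (a $\mathbb{C}^d$-valued centered weakly stationary process with this spectral density). Given $h$ as in the claim, an $h_\sharp$ as in the claim always exists and is unique up to a constant unitary factor, and the displayed form of $h^{-1}$ always exists by partial fractions. *)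

theory Defs
  imports
    "HOL-Analysis.Analysis"
    "HOL-Computational_Algebra.Computational_Algebra"
    "HOL-Computational_Algebra.Field_as_Ring"
begin

(* A rational function of z is an element of the field C(z), the fraction field of C[z].
   Its value and its poles are read off the representation in lowest terms; at a pole the
   value is the usual HOL quotient by 0. *)

type_synonym ratfun = "complex poly fract"

definition rat_pole :: "ratfun \<Rightarrow> complex \<Rightarrow> bool" where
  "rat_pole r z \<longleftrightarrow> poly (snd (quot_of_fract r)) z = 0"

definition rat_eval :: "ratfun \<Rightarrow> complex \<Rightarrow> complex" where
  "rat_eval r z = poly (fst (quot_of_fract r)) z / poly (snd (quot_of_fract r)) z"

lemma rat_eval_Fract:
  assumes "poly q z \<noteq> 0"
  shows "\<not> rat_pole (Fraction_Field.Fract p q) z"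
    and "rat_eval (Fraction_Field.Fract p q) z = poly p z / poly q z"
proof -
  let ?r = "Fraction_Field.Fract p q"
  define a b where "a = fst (quot_of_fract ?r)" and "b = snd (quot_of_fract ?r)"
  have b0: "b \<noteq> 0" and cop: "coprime a b"
    by (simp_all add: a_def b_def coprime_quot_of_fract)
  have q0: "q \<noteq> 0" using assms by auto
  have "Fraction_Field.Fract a b = ?r" by (simp add: a_def b_def)
  hence eq: "a * q = p * b" using b0 q0 by (simp add: eq_fract)
  hence "b dvd a * q" by simp
  hence "b dvd q" using cop by (simp add: coprime_commute coprime_dvd_mult_right_iff)
  hence bz: "poly b z \<noteq> 0" using assms by (auto elim!: dvdE)
  have "poly a z * poly q z = poly p z * poly b z"
    using arg_cong[OF eq, of "\<lambda>u. poly u z"] by simp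
  with bz assms show "\<not> rat_pole ?r z" "rat_eval ?r z = poly p z / poly q z"
    by (simp_all add: rat_pole_def rat_eval_def a_def[symmetric] b_def[symmetric] field_simps)
qed

definition mat_eval :: "ratfun^'n^'m \<Rightarrow> complex \<Rightarrow> complex^'n^'m" where
  "mat_eval H z = map_matrix (\<lambda>r. rat_eval r z) H"

definition ctranspose :: "complex^'n^'m \<Rightarrow> complex^'m^'n" where
  "ctranspose A = map_matrix cnj (transpose A)"

(* The rational matrix function z |-> r(z) A for a constant matrix A. *)
definition rat_scale :: "ratfun \<Rightarrow> complex^'n^'m \<Rightarrow> ratfun^'n^'m" where
  "rat_scale r A = map_matrix (\<lambda>c. r * to_fract [:c:]) A"

(* h has rational entries without poles in the closed unit disk, and det h has no zeros there. *)
definition admissible :: "ratfun^'d^'d \<Rightarrow> bool" where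
  "admissible h \<longleftrightarrow>
     (\<forall>z. norm z \<le> 1 \<longrightarrow> (\<forall>i j. \<not> rat_pole (h $ i $ j) z) \<and> det (mat_eval h z) \<noteq> 0)"

(* The right-hand side
     - rho_0 - sum_{mu=1}^K sum_{j=1}^{m_mu} (1 - cnj (p mu) z)^(-j) rho_{mu,j}
             - sum_{j=1}^{m_0} z^j rho_{0,j}
   as a matrix over C(z); here rho0 is rho_0, and [:1, - cnj (p mu):] is 1 - cnj (p mu) z. *)
definition pf_expansion ::
  "nat \<Rightarrow> (nat \<Rightarrow> complex) \<Rightarrow> (nat \<Rightarrow> nat) \<Rightarrow> complex^'d^'d \<Rightarrow> (nat \<Rightarrow> nat \<Rightarrow> complex^'d^'d)
     \<Rightarrow> ratfun^'d^'d"
where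
  "pf_expansion K p m rho0 rho =
     - rat_scale 1 rho0
     - (\<Sum>\<mu>=1..K. \<Sum>j=1..m \<mu>. rat_scale (1 / to_fract [:1, - cnj (p \<mu>):] ^ j) (rho \<mu> j))
     - (\<Sum>j=1..m 0. rat_scale (to_fract [:0, 1:] ^ j) (rho 0 j))"

(* The indices mu for which rho_{mu,m_mu} occurs: 1,...,K, and also 0 if m_0 >= 1. *)
definition pf_indices :: "nat \<Rightarrow> (nat \<Rightarrow> nat) \<Rightarrow> nat set" where
  "pf_indices K m = {\<mu>. \<mu> \<le> K \<and> (\<mu> = 0 \<longrightarrow> m 0 \<ge> 1)}"

end

theory Submission
  imports Defs
begin

text \<open>
Put $F = h^{-1}$ and $G = h_\<sharp>^{-1}$.  On the unit circle the hypothesis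
$h h^* = h_\<sharp>^* h_\<sharp>$ can be solved for $G^*$ (\<open>ctranspose_inverse_eq\<close>):
\[ G^* = h_\<sharp> \, F^* \, F . \]
There $\overline{z} = 1/z$, so conjugation turns $1/(1-\overline{p}z)^j$ into $(z/(z-p))^j$ and
$z^j$ into $(1/z)^j$.  Hence $F^*$ agrees on the circle with a rational matrix function
that is finite at infinity and has poles only at $p_0 = 0, p_1, \dots, p_K$, of orders
$m_0, \dots, m_K$; the powers of $z$ in the expansion are no exception but simply belong to the
pole $p_0 = 0$.  With $P(z) = \prod_\mu (z-p_\mu)^{m_\mu}$, the product $N = P F^*$ is a
polynomial matrix (\<open>poly_pf_num_circle\<close>).

The rational matrix function $L = h_\<sharp> N F$ has no pole in the closed disk, and on the circle it
equals $P G^*$.  But $G$ has no pole in the closed disk either, so the reflection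
$P(z)\,G(1/\overline{z})^*$ continues $L$ to the outside of the disk without poles and with growth
at most $|z|^{\deg P}$.  Therefore $L$ is a polynomial matrix of degree at most $\deg P$
(\<open>polynomial_if_reflection_regular\<close>), and the partial fractions of $L/P$
(\<open>partial_fractions\<close>), reflected back, are the required expansion of $G$.

The leading coefficients are values at the poles: $N(p_\mu)$ and $L(p_\mu)$ are
$-\rho_{\mu,m_\mu}^*$ and $-(\rho^\<sharp>_{\mu,m_\mu})^*$ times one and the same nonzero scalar
(\<open>poly_pf_num_pole\<close>).  Evaluating $L h = h_\<sharp> N$ at $p_\mu$ gives the relation between
them, and invertibility of $h_\<sharp>(p_\mu)$ shows that $\rho^\<sharp>_{\mu,m_\mu}$ cannot vanish.
\<close>

section \<open>Evaluation of rational functions\<close>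

lemma rat_as_Fract:
  assumes "\<not> rat_pole r z"
  obtains a b where "r = Fraction_Field.Fract a b" "poly b z \<noteq> 0"
  using assms unfolding rat_pole_def by (metis Fract_quot_of_fract)

lemma rat_eval_to_fract [simp]:
  "\<not> rat_pole (to_fract a) z" "rat_eval (to_fract a) z = poly a z"
  by (simp_all add: rat_pole_def rat_eval_def)

lemma rat_eval_add:
  assumes "\<not> rat_pole r z" "\<not> rat_pole s z"
  shows "\<not> rat_pole (r + s) z" "rat_eval (r + s) z = rat_eval r z + rat_eval s z"
proof -
  obtain a b where ab: "r = Fraction_Field.Fract a b" "poly b z \<noteq> 0"
    using rat_as_Fract[OF assms(1)] .
  obtain c d where cd: "s = Fraction_Field.Fract c d" "poly d z \<noteq> 0"
    using rat_as_Fract[OF assms(2)] .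
  have "b \<noteq> 0" "d \<noteq> 0" and bd: "poly (b * d) z \<noteq> 0"
    using ab(2) cd(2) by auto
  hence eq: "r + s = Fraction_Field.Fract (a * d + c * b) (b * d)"
    by (simp add: ab(1) cd(1))
  show "\<not> rat_pole (r + s) z"
    unfolding eq by (rule rat_eval_Fract(1)[OF bd])
  show "rat_eval (r + s) z = rat_eval r z + rat_eval s z"
    unfolding eq rat_eval_Fract(2)[OF bd]
    unfolding ab(1) cd(1) rat_eval_Fract(2)[OF ab(2)] rat_eval_Fract(2)[OF cd(2)]
    using ab(2) cd(2) by (simp add: add_frac_eq)
qed

lemma rat_eval_mult:
  assumes "\<not> rat_pole r z" "\<not> rat_pole s z"
  shows "\<not> rat_pole (r * s) z" "rat_eval (r * s) z = rat_eval r z * rat_eval s z"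
proof -
  obtain a b where ab: "r = Fraction_Field.Fract a b" "poly b z \<noteq> 0"
    using rat_as_Fract[OF assms(1)] .
  obtain c d where cd: "s = Fraction_Field.Fract c d" "poly d z \<noteq> 0"
    using rat_as_Fract[OF assms(2)] .
  have eq: "r * s = Fraction_Field.Fract (a * c) (b * d)"
    unfolding ab(1) cd(1) by (rule mult_fract)
  have bd: "poly (b * d) z \<noteq> 0"
    using ab(2) cd(2) by simp
  show "\<not> rat_pole (r * s) z"
    unfolding eq by (rule rat_eval_Fract(1)[OF bd])
  show "rat_eval (r * s) z = rat_eval r z * rat_eval s z"
    unfolding eq rat_eval_Fract(2)[OF bd]
    unfolding ab(1) cd(1) rat_eval_Fract(2)[OF ab(2)] rat_eval_Fract(2)[OF cd(2)] by simp
qed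

lemma rat_eval_const [simp]:
  "\<not> rat_pole 0 z" "rat_eval 0 z = 0" "\<not> rat_pole 1 z" "rat_eval 1 z = 1"
  by (simp_all add: rat_pole_def rat_eval_def)

lemma rat_eval_uminus:
  assumes "\<not> rat_pole r z"
  shows "\<not> rat_pole (- r) z" "rat_eval (- r) z = - rat_eval r z"
proof -
  obtain a b where ab: "r = Fraction_Field.Fract a b" "poly b z \<noteq> 0"
    using rat_as_Fract[OF assms] .
  have "- r = Fraction_Field.Fract (- a) b"
    unfolding ab(1) by (rule minus_fract)
  hence eq: "- r = Fraction_Field.Fract (- a) b" .
  show "\<not> rat_pole (- r) z"
    unfolding eq by (rule rat_eval_Fract(1)[OF ab(2)])
  show "rat_eval (- r) z = - rat_eval r z"
    unfolding eq unfolding ab(1) rat_eval_Fract(2)[OF ab(2)] by simp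
qed

lemma rat_eval_divide:
  assumes "\<not> rat_pole r z" "\<not> rat_pole s z" "rat_eval s z \<noteq> 0"
  shows "\<not> rat_pole (r / s) z" "rat_eval (r / s) z = rat_eval r z / rat_eval s z"
proof -
  obtain a b where ab: "r = Fraction_Field.Fract a b" "poly b z \<noteq> 0"
    using rat_as_Fract[OF assms(1)] .
  obtain c d where cd: "s = Fraction_Field.Fract c d" "poly d z \<noteq> 0"
    using rat_as_Fract[OF assms(2)] .
  have c: "poly c z \<noteq> 0"
    using assms(3) cd by (simp add: rat_eval_Fract)
  have eq: "r / s = Fraction_Field.Fract (a * d) (b * c)"
    unfolding ab(1) cd(1) by (rule divide_fract)
  have bc: "poly (b * c) z \<noteq> 0"
    using ab(2) c by simp
  show "\<not> rat_pole (r / s) z"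
    unfolding eq by (rule rat_eval_Fract(1)[OF bc])
  show "rat_eval (r / s) z = rat_eval r z / rat_eval s z"
    unfolding eq rat_eval_Fract(2)[OF bc]
    unfolding ab(1) cd(1) rat_eval_Fract(2)[OF ab(2)] rat_eval_Fract(2)[OF cd(2)] by simp
qed

lemma rat_eval_power:
  assumes "\<not> rat_pole r z"
  shows "\<not> rat_pole (r ^ n) z \<and> rat_eval (r ^ n) z = rat_eval r z ^ n"
  using assms by (induction n) (auto simp: rat_eval_mult)

lemma rat_eval_sum:
  assumes "\<And>x. x \<in> X \<Longrightarrow> \<not> rat_pole (f x) z"
  shows "\<not> rat_pole (sum f X) z \<and> rat_eval (sum f X) z = (\<Sum>x\<in>X. rat_eval (f x) z)"
  using assms by (induction X rule: infinite_finite_induct) (auto simp: rat_eval_add)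

lemma rat_eval_prod:
  assumes "\<And>x. x \<in> X \<Longrightarrow> \<not> rat_pole (f x) z"
  shows "\<not> rat_pole (prod f X) z \<and> rat_eval (prod f X) z = (\<Prod>x\<in>X. rat_eval (f x) z)"
  using assms by (induction X rule: infinite_finite_induct) (auto simp: rat_eval_mult)

lemma poly_eqI_infinite:
  fixes a b :: "'a::idom poly"
  assumes "infinite S" "\<And>z. z \<in> S \<Longrightarrow> poly a z = poly b z"
  shows "a = b"
proof (rule ccontr)
  assume "a \<noteq> b"
  hence "finite {z. poly (a - b) z = 0}"
    by (intro poly_roots_finite) simp
  moreover have "S \<subseteq> {z. poly (a - b) z = 0}"
    using assms(2) by auto
  ultimately show False
    using assms(1) finite_subset by blast
qed

lemma ratfun_eqI:
  assumes "infinite S"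
    and "\<And>z. z \<in> S \<Longrightarrow> \<not> rat_pole r z \<and> \<not> rat_pole s z \<and> rat_eval r z = rat_eval s z"
  shows "r = s"
proof -
  define a b where "a = fst (quot_of_fract r)" and "b = snd (quot_of_fract r)"
  define c d where "c = fst (quot_of_fract s)" and "d = snd (quot_of_fract s)"
  have "a * d = c * b"
  proof (rule poly_eqI_infinite[OF assms(1)])
    fix z assume "z \<in> S"
    from assms(2)[OF this] have "poly b z \<noteq> 0" "poly d z \<noteq> 0"
      "poly a z / poly b z = poly c z / poly d z"
      by (simp_all add: rat_pole_def rat_eval_def a_def b_def c_def d_def)
    thus "poly (a * d) z = poly (c * b) z"
      by (simp add: frac_eq_eq)
  qed
  moreover have "b \<noteq> 0" "d \<noteq> 0"
    by (simp_all add: b_def d_def)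
  moreover have "r = Fraction_Field.Fract a b" "s = Fraction_Field.Fract c d"
    by (simp_all add: a_def b_def c_def d_def)
  ultimately show ?thesis
    by (simp add: eq_fract)
qed

section \<open>Evaluation of rational matrix functions\<close>

definition mat_regular :: "ratfun^'n^'m \<Rightarrow> complex \<Rightarrow> bool" where
  "mat_regular A z \<longleftrightarrow> (\<forall>i j. \<not> rat_pole (A $ i $ j) z)"

lemma mat_eval_nth [simp]: "mat_eval A z $ i $ j = rat_eval (A $ i $ j) z"
  by (simp add: mat_eval_def)

lemma mat_eval_mult:
  assumes "mat_regular A z" "mat_regular B z"
  shows "mat_regular (A ** B) z" "mat_eval (A ** B) z = mat_eval A z ** mat_eval B z"
proof -
  have "\<not> rat_pole ((A ** B) $ i $ j) z \<and>
        rat_eval ((A ** B) $ i $ j) z = (mat_eval A z ** mat_eval B z) $ i $ j" for i j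
    using assms
      rat_eval_sum[of UNIV "\<lambda>k. A $ i $ k * B $ k $ j" z]
    by (simp add: matrix_matrix_mult_def mat_regular_def rat_eval_mult)
  thus "mat_regular (A ** B) z" "mat_eval (A ** B) z = mat_eval A z ** mat_eval B z"
    by (simp_all add: mat_regular_def vec_eq_iff)
qed

lemma mat_eval_mat_1: "mat_eval (mat 1) z = mat 1"
  by (simp add: vec_eq_iff mat_def)

lemma rat_eval_det:
  assumes "mat_regular A z"
  shows "\<not> rat_pole (det A) z" "rat_eval (det A) z = det (mat_eval A z)"
proof -
  let ?t = "\<lambda>\<pi>. of_int (sign \<pi>) * (\<Prod>i\<in>UNIV. A $ i $ \<pi> i)"
  have 1: "\<not> rat_pole (\<Prod>i\<in>UNIV. A $ i $ \<pi> i) z \<and>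
     rat_eval (\<Prod>i\<in>UNIV. A $ i $ \<pi> i) z = (\<Prod>i\<in>UNIV. mat_eval A z $ i $ \<pi> i)" for \<pi>
    using assms rat_eval_prod[of UNIV "\<lambda>i. A $ i $ \<pi> i" z] by (simp add: mat_regular_def)
  have 2: "\<not> rat_pole (?t \<pi>) z \<and>
     rat_eval (?t \<pi>) z = of_int (sign \<pi>) * (\<Prod>i\<in>UNIV. mat_eval A z $ i $ \<pi> i)" for \<pi>
    using 1[of \<pi>] by (cases \<pi> rule: sign_cases) (simp_all add: rat_eval_uminus)
  have 3: "\<not> rat_pole (\<Sum>\<pi> | \<pi> permutes UNIV. ?t \<pi>) z \<and>
     rat_eval (\<Sum>\<pi> | \<pi> permutes UNIV. ?t \<pi>) z = (\<Sum>\<pi> | \<pi> permutes UNIV. rat_eval (?t \<pi>) z)"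
    by (rule rat_eval_sum) (use 2 in blast)
  show "\<not> rat_pole (det A) z"
    unfolding det_def using 3 by blast
  show "rat_eval (det A) z = det (mat_eval A z)"
    using 2 3 by (simp only: det_def)
qed

text \<open>
By Cramer's rule the entries of the inverse are quotients of determinants by \<open>det A\<close>, which has
no zero at \<open>z\<close>.
\<close>

lemma mat_regular_inv:
  fixes A :: "ratfun^'n^'n"
  assumes reg: "mat_regular A z" and nz: "det (mat_eval A z) \<noteq> 0"
  shows "A ** matrix_inv A = mat 1" "matrix_inv A ** A = mat 1" "mat_regular (matrix_inv A) z"
proof -
  have ev: "rat_eval (det A) z \<noteq> 0" and dreg: "\<not> rat_pole (det A) z"
    using rat_eval_det[OF reg] nz by simp_all
  have det: "det A \<noteq> 0"
    using ev by auto
  hence "\<exists>B. A ** B = mat 1 \<and> B ** A = mat 1"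
    using invertible_det_nz[of A] by (simp add: invertible_def)
  hence inv: "A ** matrix_inv A = mat 1 \<and> matrix_inv A ** A = mat 1"
    unfolding matrix_inv_def by (rule someI_ex)
  thus "A ** matrix_inv A = mat 1" "matrix_inv A ** A = mat 1"
    by simp_all
  show "mat_regular (matrix_inv A) z"
    unfolding mat_regular_def
  proof (intro allI)
    fix k l
    let ?C = "(\<chi> i j. if j = k then (mat 1 :: ratfun^'n^'n) $ i $ l else A $ i $ j) :: ratfun^'n^'n"
    have "(A *v column l (matrix_inv A)) $ i = (A ** matrix_inv A) $ i $ l" for i
      by (simp add: matrix_vector_mult_def matrix_matrix_mult_def column_def)
    hence "?C = (\<chi> i j. if j = k then (A *v column l (matrix_inv A)) $ i else A $ i $ j)"
      by (simp add: inv vec_eq_iff)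
    hence "det ?C = matrix_inv A $ k $ l * det A"
      using cramer_lemma[of k A "column l (matrix_inv A)"] by (simp add: column_def)
    hence eq: "matrix_inv A $ k $ l = det ?C / det A"
      using det by (simp add: field_simps)
    have "mat_regular ?C z"
      using reg by (simp add: mat_regular_def mat_def)
    thus "\<not> rat_pole (matrix_inv A $ k $ l) z"
      unfolding eq by (intro rat_eval_divide rat_eval_det dreg ev)
  qed
qed

lemma ctranspose_nth [simp]: "ctranspose A $ i $ j = cnj (A $ j $ i)"
  by (simp add: ctranspose_def transpose_def)

lemma ctranspose_mult: "ctranspose (A ** B) = ctranspose B ** ctranspose A"
  by (simp add: vec_eq_iff matrix_matrix_mult_def mult.commute)

lemma ctranspose_mat_1: "ctranspose (mat 1) = mat 1"
  by (simp add: vec_eq_iff mat_def)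

lemma ctranspose_ctranspose [simp]: "ctranspose (ctranspose A) = A"
  by (simp add: vec_eq_iff)

text \<open>
The matrix $s f^* f$ is a right inverse of $s^*$, because $s^* s f^* f = a\,(f a)^* f = 1$.
\<close>

lemma ctranspose_inverse_eq:
  fixes a f s g :: "complex^'d^'d"
  assumes "a ** f = mat 1" "f ** a = mat 1" "s ** g = mat 1"
    and "a ** ctranspose a = ctranspose s ** s"
  shows "ctranspose g = s ** ctranspose f ** f"
proof -
  have "ctranspose s ** (s ** ctranspose f ** f) = a ** (ctranspose a ** ctranspose f) ** f"
    by (metis assms(4) matrix_mul_assoc)
  also have "\<dots> = mat 1"
    using assms(1,2) by (simp add: ctranspose_mult[symmetric] ctranspose_mat_1)
  finally have *: "ctranspose s ** (s ** ctranspose f ** f) = mat 1" .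
  have "ctranspose g = ctranspose g ** (ctranspose s ** (s ** ctranspose f ** f))"
    by (simp add: *)
  also have "\<dots> = ctranspose (s ** g) ** (s ** ctranspose f ** f)"
    by (simp add: ctranspose_mult matrix_mul_assoc)
  finally show ?thesis
    by (simp add: assms(3) ctranspose_mat_1)
qed

section \<open>Reflection in the unit circle\<close>

lemma infinite_circle: "infinite {z::complex. norm z = 1}"
proof
  assume "finite {z::complex. norm z = 1}"
  moreover have "cis ` {0..1} \<subseteq> {z. norm z = 1}"
    by auto
  ultimately have "finite (cis ` {0..1})"
    by (rule finite_subset[rotated])
  moreover have "inj_on cis {0..1}"
  proof (rule inj_onI)
    fix x y :: real assume "x \<in> {0..1}" "y \<in> {0..1}" "cis x = cis y"
    hence "cos x = cos y" "0 \<le> x" "x \<le> pi" "0 \<le> y" "y \<le> pi"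
      using pi_gt3 by (auto simp: complex_eq_iff)
    thus "x = y" by (metis cos_inj_pi)
  qed
  ultimately have "finite {0..1::real}"
    by (rule finite_imageD)
  thus False by (simp add: infinite_Icc)
qed

lemma circle_cis:
  assumes "norm (z::complex) = 1"
  obtains \<theta> where "- pi \<le> \<theta>" "\<theta> < pi" "z = cis \<theta>"
proof (cases "Arg z = pi")
  case True
  have "z = cis pi" using assms True by (metis cis_Arg norm_zero sgn_eq scaleR_one div_by_1 of_real_1 zero_neq_one)
  hence "z = cis (- pi)" by (simp add: complex_eq_iff)
  thus ?thesis using that[of "- pi"] by simp
next
  case False
  have "z = cis (Arg z)" using assms by (metis cis_Arg norm_zero sgn_eq div_by_1 of_real_1 zero_neq_one)
  thus ?thesis using that[of "Arg z"] False Arg_bounded[of z] by simp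
qed

text \<open>
Inside the circle $l$ is finite by assumption; outside it equals $P(z)\,\overline{g(1/\overline{z})}$,
which is finite there and grows at most like $|z|^{\deg P}$.  For rational functions
$l = a/b$ and $g = c/d$ in lowest terms this becomes a polynomial identity.  On the circle the
conjugate of a polynomial $q$ is $z^{-\deg q}$ times its reflection $q^\sim$ with reversed and
conjugated coefficients, so $a\,d^\sim z^{\deg c} = P\,c^\sim z^{\deg d}\,b$.  The zeros of $b$ lie
outside the closed disk, those of $d^\sim z^{\deg c}$ lie in the open disk, and $b$ is coprime to $a$;
hence $b$ is constant, and comparing degrees bounds $\deg a$.
\<close>

lemma polynomial_if_reflection_regular:
  fixes l g :: ratfun
  assumes l: "\<And>z. norm z \<le> 1 \<Longrightarrow> \<not> rat_pole l z"
    and g: "\<And>z. norm z \<le> 1 \<Longrightarrow> \<not> rat_pole g z"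
    and eq: "\<And>z. norm z = 1 \<Longrightarrow> rat_eval l z = poly P z * cnj (rat_eval g z)"
    and P: "P \<noteq> 0"
  obtains A where "l = to_fract A" "degree A \<le> degree P"
proof -
  define a b where "a = fst (quot_of_fract l)" and "b = snd (quot_of_fract l)"
  define c d where "c = fst (quot_of_fract g)" and "d = snd (quot_of_fract g)"
  define refl where "refl q = reflect_poly (map_poly cnj q)" for q
  have refl: "poly (refl q) z = z ^ degree q * cnj (poly q (inverse (cnj z)))" if "z \<noteq> 0" for q z
    using that by (simp add: refl_def poly_reflect_poly_nz degree_map_poly)
  have l_eq: "l = Fraction_Field.Fract a b" and b0: "b \<noteq> 0" and cop: "coprime a b"
    by (simp_all add: a_def b_def coprime_quot_of_fract)
  have b: "poly b z \<noteq> 0" and d: "poly d z \<noteq> 0" if "norm z \<le> 1" for z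
    using l[OF that] g[OF that] by (simp_all add: rat_pole_def b_def d_def)
  have poly_eq: "a * (refl d * [:0, 1:] ^ degree c) = P * (refl c * [:0, 1:] ^ degree d) * b"
  proof (rule poly_eqI_infinite[OF infinite_circle])
    fix z :: complex assume "z \<in> {z. norm z = 1}"
    hence z: "norm z = 1" by simp
    hence z0: "z \<noteq> 0" and inv: "inverse (cnj z) = z"
      using complex_norm_square[of z] by (auto intro!: inverse_unique simp: mult.commute)
    have "poly a z / poly b z = poly P z * cnj (poly c z / poly d z)"
      using eq[OF z] by (simp add: rat_eval_def a_def b_def c_def d_def)
    hence "poly a z * cnj (poly d z) = poly P z * cnj (poly c z) * poly b z"
      using b[of z] d[of z] z by (simp add: field_simps)
    thus "poly (a * (refl d * [:0, 1:] ^ degree c)) z =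
          poly (P * (refl c * [:0, 1:] ^ degree d) * b) z"
      by (simp add: refl[OF z0] inv)
  qed
  have "degree b = 0"
  proof (rule ccontr)
    assume "degree b \<noteq> 0"
    then obtain z where z: "poly b z = 0"
      using fundamental_theorem_of_algebra constant_degree by (metis neq0_conv)
    have "norm z > 1" using b[of z] z by force
    hence z0: "z \<noteq> 0" by auto
    have "b dvd a * (refl d * [:0, 1:] ^ degree c)"
      by (simp add: poly_eq)
    hence "b dvd refl d * [:0, 1:] ^ degree c"
      using cop by (simp add: coprime_commute coprime_dvd_mult_right_iff)
    then obtain k where "refl d * [:0, 1:] ^ degree c = b * k"
      by (rule dvdE)
    hence "poly (refl d * [:0, 1:] ^ degree c) z = poly (b * k) z"
      by (rule arg_cong)
    hence "poly (refl d * [:0, 1:] ^ degree c) z = 0"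
      by (simp add: z)
    hence "poly d (inverse (cnj z)) = 0"
      using z0 by (simp add: refl)
    moreover have "norm (inverse (cnj z)) \<le> 1"
      using \<open>norm z > 1\<close> by (simp add: norm_inverse inverse_le_1_iff)
    ultimately show False using d by blast
  qed
  then obtain \<beta> where \<beta>: "b = [:\<beta>:]" by (metis degree_eq_zeroE)
  with b0 have \<beta>0: "\<beta> \<noteq> 0" by simp
  have "l = to_fract (smult (inverse \<beta>) a)"
    using \<beta>0 by (simp add: l_eq \<beta> to_fract_def eq_fract)
  moreover have "degree a \<le> degree P"
  proof (cases "a = 0")
    case False
    have "d \<noteq> 0" by (simp add: d_def)
    moreover have "map_poly cnj d \<noteq> 0"
      using \<open>d \<noteq> 0\<close> by (simp add: map_poly_eq_0_iff)
    moreover have "coeff (map_poly cnj d) 0 \<noteq> 0"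
      using d[of 0] by (simp add: coeff_map_poly poly_0_coeff_0)
    \<comment> \<open>Reversing a nonzero polynomial preserves its degree exactly when 0 is not a root.\<close>
    ultimately have d': "refl d \<noteq> 0" "degree (refl d) = degree d"
      by (simp_all add: refl_def degree_map_poly)
    have c': "degree (refl c) \<le> degree c"
      using degree_reflect_poly_le[of "map_poly cnj c"] by (simp add: refl_def degree_map_poly)
    have X: "[:0, 1::complex:] ^ n \<noteq> 0" "degree ([:0, 1::complex:] ^ n) = n" for n
      by (simp_all add: degree_power_eq)
    have "degree (a * (refl d * [:0, 1:] ^ degree c)) = degree a + degree d + degree c"
      using False d' X by (simp add: degree_mult_eq)
    moreover have "degree (P * (refl c * [:0, 1:] ^ degree d) * b) \<le> degree P + degree c + degree d"
    proof -
      have "degree (P * (refl c * [:0, 1:] ^ degree d) * b) \<le>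
            (degree P + (degree (refl c) + degree ([:0, 1::complex:] ^ degree d))) + degree b"
        by (meson add_le_mono degree_mult_le order_trans le_refl)
      thus ?thesis using c' X \<open>degree b = 0\<close> by simp
    qed
    ultimately show ?thesis using poly_eq by simp
  qed simp
  ultimately show ?thesis
    using that[of "smult (inverse \<beta>) a"] \<beta>0 by simp
qed

section \<open>Partial fractions with prescribed numerators\<close>

text \<open>
The numerator of $c_0 + \sum_i \sum_{j=1}^{m_i} c_{ij}\,(e_i(z)/(z-p_i))^j$ over the common
denominator $\prod_i (z-p_i)^{m_i}$.  The free numerators $e_i$ let one formula cover both the
basis functions $(z/(z-p_\mu))^j$ and $(1/z)^j$, which arise by reflection in the circle.
\<close>

definition pf_num ::
  "'i set \<Rightarrow> ('i \<Rightarrow> 'a::comm_ring_1) \<Rightarrow> ('i \<Rightarrow> 'a poly) \<Rightarrow> ('i \<Rightarrow> nat) \<Rightarrow>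
     'a \<Rightarrow> ('i \<Rightarrow> nat \<Rightarrow> 'a) \<Rightarrow> 'a poly"
where
  "pf_num I p e m c0 c =
     smult c0 (\<Prod>i\<in>I. [:- p i, 1:] ^ m i) +
     (\<Sum>(i, j)\<in>Sigma I (\<lambda>i. {1..m i}).
        smult (c i j) (e i ^ j * [:- p i, 1:] ^ (m i - j) * (\<Prod>k\<in>I - {i}. [:- p k, 1:] ^ m k)))"

lemma poly_pf_num:
  fixes p :: "'i \<Rightarrow> 'a::field"
  assumes "finite I" "z \<notin> p ` I"
  shows "poly (pf_num I p e m c0 c) z =
    poly (\<Prod>i\<in>I. [:- p i, 1:] ^ m i) z *
      (c0 + (\<Sum>(i, j)\<in>Sigma I (\<lambda>i. {1..m i}). c i j * (poly (e i) z / (z - p i)) ^ j))"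
proof -
  have "c i j * (poly (e i) z ^ j * (z - p i) ^ (m i - j) * (\<Prod>k\<in>I - {i}. (z - p k) ^ m k)) =
        (\<Prod>i\<in>I. (z - p i) ^ m i) * (c i j * (poly (e i) z / (z - p i)) ^ j)"
    if "i \<in> I" "j \<in> {1..m i}" for i j
  proof -
    have "z - p i \<noteq> 0" using that assms by auto
    moreover from this have "(z - p i) ^ m i = (z - p i) ^ (m i - j) * (z - p i) ^ j"
      using that by (simp flip: power_add)
    ultimately show ?thesis
      by (simp add: prod.remove[OF assms(1) that(1)] power_divide)
  qed
  thus ?thesis
    by (auto simp: pf_num_def poly_sum poly_prod distrib_left sum_distrib_left
        case_prod_unfold intro!: sum.cong)
qed

text \<open>
At $p_i$ every summand that keeps a factor $z-p_i$ vanishes, so only the coefficient of highest order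
at $p_i$ survives.  Its scalar factor depends on the poles alone, which is what allows the leading
coefficients of two expansions with the same poles to be compared.
\<close>

lemma poly_pf_num_pole:
  fixes p :: "'i \<Rightarrow> 'a::field"
  assumes "finite I" "inj_on p I" "i \<in> I" "m i \<ge> 1"
  shows "poly (pf_num I p e m c0 c) (p i) =
    c i (m i) * (poly (e i) (p i) ^ m i * (\<Prod>k\<in>I - {i}. (p i - p k) ^ m k))"
proof -
  let ?t = "\<lambda>(l, j). c l j * (poly (e l) (p i) ^ j * (p i - p l) ^ (m l - j) *
      (\<Prod>k\<in>I - {l}. (p i - p k) ^ m k))"
  have zero: "?t x = 0" if "x \<in> Sigma I (\<lambda>i. {1..m i}) - {(i, m i)}" for x
  proof -
    obtain l j where x: "x = (l, j)" by force
    show ?thesis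
    proof (cases "l = i")
      case True
      thus ?thesis using that x by auto
    next
      case False
      hence "(\<Prod>k\<in>I - {l}. (p i - p k) ^ m k) = 0"
        using assms by (intro prod_zero) (auto intro!: bexI[of _ i])
      thus ?thesis by (simp add: x)
    qed
  qed
  have "(\<Prod>k\<in>I. (p i - p k) ^ m k) = 0"
    using assms by (intro prod_zero) (auto intro!: bexI[of _ i])
  hence "poly (pf_num I p e m c0 c) (p i) = (\<Sum>x\<in>Sigma I (\<lambda>i. {1..m i}). ?t x)"
    by (simp add: pf_num_def poly_sum poly_prod case_prod_unfold)
  also have "\<dots> = (\<Sum>x\<in>{(i, m i)}. ?t x)"
    using assms zero by (intro sum.mono_neutral_right) auto
  finally show ?thesis by simp
qed

text \<open>
Induction on the total order of the poles: the right multiple of $(e_i(z)/(z-p_i))^{m_i}$ removes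
the highest-order part at $p_i$ and lowers that order by one.  Since $e_i$ has degree at most $1$, the
numerator removed has degree at most that of the denominator, so no polynomial part builds up and
only a constant is left at the end.
\<close>

lemma partial_fractions:
  fixes p :: "'i \<Rightarrow> 'a::field"
  assumes "finite I" "inj_on p I"
    and "\<And>i. i \<in> I \<Longrightarrow> degree (e i) \<le> 1" "\<And>i. i \<in> I \<Longrightarrow> poly (e i) (p i) \<noteq> 0"
    and "degree M \<le> (\<Sum>i\<in>I. m i)"
  shows "\<exists>c0 c. \<forall>z. z \<notin> p ` I \<longrightarrow>
    poly M z / poly (\<Prod>i\<in>I. [:- p i, 1:] ^ m i) z =
      c0 + (\<Sum>(i, j)\<in>Sigma I (\<lambda>i. {1..m i}). c i j * (poly (e i) z / (z - p i)) ^ j)"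
  using assms(5)
proof (induction "\<Sum>i\<in>I. m i" arbitrary: m M)
  case 0
  hence m: "m i = 0" if "i \<in> I" for i using that assms(1) by simp
  obtain c0 where "M = [:c0:]" using 0 by (metis degree_eq_zeroE le_zero_eq)
  moreover have "Sigma I (\<lambda>i. {1..m i}) = {}" using m by auto
  ultimately show ?case using m by (auto simp: poly_prod)
next
  case (Suc n)
  then obtain i where i: "i \<in> I" "m i \<noteq> 0" using assms(1)
    by (metis sum.neutral nat.distinct(1))
  define R where "R = (\<Prod>k\<in>I - {i}. [:- p k, 1:] ^ m k)"
  have R0: "poly R (p i) \<noteq> 0"
  proof -
    have "finite (I - {i})" "\<And>k. k \<in> I - {i} \<Longrightarrow> p k \<noteq> p i"
      using assms(1,2) i by (auto simp: inj_on_def)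
    moreover have "poly R (p i) = (\<Prod>k\<in>I - {i}. (p i - p k) ^ m k)"
      by (simp add: R_def poly_prod uminus_add_conv_diff)
    ultimately show ?thesis by force
  qed
  have degR: "degree R = (\<Sum>k\<in>I - {i}. m k)"
    by (simp add: R_def degree_prod_sum_eq degree_power_eq)
  have sum: "(\<Sum>k\<in>I. m k) = m i + (\<Sum>k\<in>I - {i}. m k)"
    using assms(1) i by (simp add: sum.remove)
  \<comment> \<open>This choice makes \<open>M - r * e i ^ m i * R\<close> vanish at \<open>p i\<close>.\<close>
  define r where "r = poly M (p i) / (poly (e i) (p i) ^ m i * poly R (p i))"
  have "poly (M - smult r (e i ^ m i * R)) (p i) = 0"
    using R0 assms(4)[OF i(1)] by (simp add: r_def)
  hence "[:- p i, 1:] dvd M - smult r (e i ^ m i * R)"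
    by (simp only: poly_eq_0_iff_dvd)
  then obtain M' where M': "M - smult r (e i ^ m i * R) = [:- p i, 1:] * M'"
    by (rule dvdE)
  define m' where "m' = m(i := m i - 1)"
  have sum': "(\<Sum>k\<in>I. m' k) = m i - 1 + (\<Sum>k\<in>I - {i}. m k)"
  proof -
    have "(\<Sum>k\<in>I - {i}. m' k) = (\<Sum>k\<in>I - {i}. m k)"
      by (intro sum.cong) (auto simp: m'_def)
    thus ?thesis using assms(1) i by (simp add: sum.remove m'_def)
  qed
  have n: "n = (\<Sum>k\<in>I. m' k)"
    using Suc(2) sum sum' i by simp
  have "degree (e i ^ m i * R) \<le> (\<Sum>k\<in>I. m k)"
  proof -
    have "degree (e i ^ m i * R) \<le> degree (e i) * m i + degree R"
      by (meson add_le_mono degree_mult_le degree_power_le order_trans le_refl)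
    also have "\<dots> \<le> 1 * m i + degree R"
      using assms(3)[OF i(1)] by (intro add_mono mult_mono) auto
    finally show ?thesis by (simp add: sum degR)
  qed
  hence "degree ([:- p i, 1:] * M') \<le> Suc n"
    unfolding M'[symmetric] using Suc(2,3)
    by (intro degree_diff_le) (auto intro: order_trans[OF degree_smult_le])
  hence "degree M' \<le> (\<Sum>k\<in>I. m' k)"
    by (cases "M' = 0") (auto simp: degree_mult_eq n simp del: mult_pCons_left)
  from Suc(1)[OF n this] obtain c0 c where IH: "\<And>z. z \<notin> p ` I \<Longrightarrow>
    poly M' z / poly (\<Prod>k\<in>I. [:- p k, 1:] ^ m' k) z =
      c0 + (\<Sum>(k, j)\<in>Sigma I (\<lambda>i. {1..m' i}). c k j * (poly (e k) z / (z - p k)) ^ j)"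
    by blast
  define c' where "c' = c(i := (c i)(m i := r))"
  have Sig: "Sigma I (\<lambda>i. {1..m i}) = insert (i, m i) (Sigma I (\<lambda>i. {1..m' i}))"
    using i by (auto simp: m'_def split: if_splits)
  have new: "(i, m i) \<notin> Sigma I (\<lambda>i. {1..m' i})"
    using i by (auto simp: m'_def)
  show ?case
  proof (intro exI allI impI)
    fix z assume z: "z \<notin> p ` I"
    let ?g = "\<lambda>c (k, j). c k j * (poly (e k) z / (z - p k)) ^ j"
    have zi: "z - p i \<noteq> 0" using z i by auto
    have Rz: "poly R z \<noteq> 0" using z assms(1) by (auto simp: R_def poly_prod)
    have P: "poly (\<Prod>k\<in>I. [:- p k, 1:] ^ m k) z = (z - p i) ^ m i * poly R z"
      using i by (simp add: R_def poly_prod prod.remove[OF assms(1)])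
    have P': "poly (\<Prod>k\<in>I. [:- p k, 1:] ^ m' k) z = (z - p i) ^ (m i - 1) * poly R z"
    proof -
      have "(\<Prod>k\<in>I - {i}. (z - p k) ^ m' k) = (\<Prod>k\<in>I - {i}. (z - p k) ^ m k)"
        by (intro prod.cong) (auto simp: m'_def)
      thus ?thesis
        using i by (simp add: R_def poly_prod prod.remove[OF assms(1)] m'_def)
    qed
    have "M = smult r (e i ^ m i * R) + [:- p i, 1:] * M'"
      unfolding M'[symmetric] by simp
    hence "poly M z = poly (smult r (e i ^ m i * R) + [:- p i, 1:] * M') z"
      by (rule arg_cong)
    hence "poly M z = r * (poly (e i) z ^ m i * poly R z) + (z - p i) * poly M' z"
      by (simp add: left_diff_distrib)
    moreover have "(z - p i) ^ m i = (z - p i) * (z - p i) ^ (m i - 1)"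
      using i by (metis power_eq_if)
    ultimately have "poly M z / poly (\<Prod>k\<in>I. [:- p k, 1:] ^ m k) z =
        r * (poly (e i) z / (z - p i)) ^ m i + poly M' z / poly (\<Prod>k\<in>I. [:- p k, 1:] ^ m' k) z"
      using zi Rz unfolding P P' by (simp add: power_divide add_divide_distrib)
    also have "\<dots> = c0 + (?g c' (i, m i) + (\<Sum>x\<in>Sigma I (\<lambda>i. {1..m' i}). ?g c x))"
      by (simp add: IH[OF z] c'_def)
    also have "(\<Sum>x\<in>Sigma I (\<lambda>i. {1..m' i}). ?g c x) = (\<Sum>x\<in>Sigma I (\<lambda>i. {1..m' i}). ?g c' x)"
      using new by (intro sum.cong) (auto simp: c'_def)
    also have "?g c' (i, m i) + \<dots> = (\<Sum>x\<in>Sigma I (\<lambda>i. {1..m i}). ?g c' x)"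
      unfolding Sig using new assms(1) by (subst sum.insert) auto
    finally show "poly M z / poly (\<Prod>k\<in>I. [:- p k, 1:] ^ m k) z =
      c0 + (\<Sum>(k, j)\<in>Sigma I (\<lambda>i. {1..m i}). c' k j * (poly (e k) z / (z - p k)) ^ j)" .
  qed
qed

section \<open>Matrix expansions on the unit circle\<close>

text \<open>
On the circle the conjugate of $1/(1-\overline{p_\mu}z)$ is $z/(z-p_\mu)$, while for the
polynomial part, indexed by $\mu = 0$ with $p_0 = 0$, the conjugate of $z$ is $1/z = 1/(z-p_0)$.
\<close>

definition circ_num :: "nat \<Rightarrow> complex poly" where
  "circ_num \<mu> = (if \<mu> = 0 then 1 else [:0, 1:])"

text \<open>
The two parts of the expansion merge into one sum over $\mu = 0,\dots,K$ once their
basis functions are written as conjugates.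
\<close>

lemma rat_eval_pf_expansion:
  assumes z: "norm z = 1" and p0: "p 0 = 0" and p: "\<forall>\<mu>\<in>{1..K}. norm (p \<mu>) < 1"
  shows "\<not> rat_pole (pf_expansion K p m r0 r $ i $ j) z \<and>
    rat_eval (pf_expansion K p m r0 r $ i $ j) z =
      - (r0 $ i $ j + (\<Sum>(\<mu>, k)\<in>Sigma {0..K} (\<lambda>\<mu>. {1..m \<mu>}).
            r \<mu> k $ i $ j * cnj ((poly (circ_num \<mu>) z / (z - p \<mu>)) ^ k)))"
proof -
  define t :: "nat \<Rightarrow> nat \<Rightarrow> ratfun" where
    "t \<mu> k = (if \<mu> = 0 then to_fract [:0, 1:] ^ k else 1 / to_fract [:1, - cnj (p \<mu>):] ^ k)" for \<mu> k
  have zz: "z * cnj z = 1" and z0: "z \<noteq> 0"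
    using complex_norm_square[of z] z by auto
  have t: "\<not> rat_pole (t \<mu> k) z \<and>
      rat_eval (t \<mu> k) z = cnj ((poly (circ_num \<mu>) z / (z - p \<mu>)) ^ k)" if "\<mu> \<in> {0..K}" for \<mu> k
  proof (cases "\<mu> = 0")
    case True
    have "z = cnj (1 / z)"
      using zz z0 by (simp add: field_simps)
    thus ?thesis
      using True p0 rat_eval_power[of "to_fract [:0, 1:]" z k]
      by (simp add: t_def circ_num_def)
  next
    case False
    hence "norm (p \<mu>) < 1" using p that by simp
    hence zp: "z \<noteq> p \<mu>" using z by auto
    have eq: "cnj (z / (z - p \<mu>)) * (1 - cnj (p \<mu>) * z) = 1"
    proof -
      have "1 - cnj (p \<mu>) * z = z * cnj (z - p \<mu>)"
        using zz by (simp add: algebra_simps)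
      moreover have "cnj (z - p \<mu>) \<noteq> 0" using zp by simp
      ultimately show ?thesis
        using zz by (simp add: mult.commute)
    qed
    hence nz: "1 - cnj (p \<mu>) * z \<noteq> 0" by auto
    have pw: "\<not> rat_pole (to_fract [:1, - cnj (p \<mu>):] ^ k) z \<and>
       rat_eval (to_fract [:1, - cnj (p \<mu>):] ^ k) z = (1 - cnj (p \<mu>) * z) ^ k"
      using rat_eval_power[of "to_fract [:1, - cnj (p \<mu>):]" z k]
      by (simp add: mult.commute)
    have "cnj (z / (z - p \<mu>)) = 1 / (1 - cnj (p \<mu>) * z)"
      using eq nz by (metis nonzero_eq_divide_eq)
    hence "cnj ((z / (z - p \<mu>)) ^ k) = 1 / (1 - cnj (p \<mu>) * z) ^ k"
      by (metis complex_cnj_power power_divide power_one)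
    thus ?thesis
      using False nz pw rat_eval_divide[of 1 z "to_fract [:1, - cnj (p \<mu>):] ^ k"]
      by (simp add: t_def circ_num_def)
  qed
  let ?s = "\<lambda>(\<mu>, k). t \<mu> k * to_fract [:r \<mu> k $ i $ j:]"
  have "pf_expansion K p m r0 r $ i $ j =
     - to_fract [:r0 $ i $ j:]
     - (\<Sum>\<mu>=1..K. \<Sum>k=1..m \<mu>. ?s (\<mu>, k)) - (\<Sum>k=1..m 0. ?s (0, k))"
    by (simp add: pf_expansion_def rat_scale_def t_def)
  also have "\<dots> = - (to_fract [:r0 $ i $ j:] + (\<Sum>\<mu>\<in>{0..K}. \<Sum>k=1..m \<mu>. ?s (\<mu>, k)))"
    by (simp add: sum.atLeast_Suc_atMost)
  also have "(\<Sum>\<mu>\<in>{0..K}. \<Sum>k=1..m \<mu>. ?s (\<mu>, k)) = sum ?s (Sigma {0..K} (\<lambda>\<mu>. {1..m \<mu>}))"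
    by (subst sum.Sigma) simp_all
  finally have eq: "pf_expansion K p m r0 r $ i $ j =
    - (to_fract [:r0 $ i $ j:] + sum ?s (Sigma {0..K} (\<lambda>\<mu>. {1..m \<mu>})))" .
  have s: "\<not> rat_pole (?s x) z \<and> rat_eval (?s x) z = (case x of (\<mu>, k) \<Rightarrow>
      r \<mu> k $ i $ j * cnj ((poly (circ_num \<mu>) z / (z - p \<mu>)) ^ k))"
    if "x \<in> Sigma {0..K} (\<lambda>\<mu>. {1..m \<mu>})" for x
    using that t rat_eval_mult[of "t (fst x) (snd x)" z "to_fract [:r (fst x) (snd x) $ i $ j:]"]
    by (auto simp: mult.commute)
  have sm: "\<not> rat_pole (sum ?s (Sigma {0..K} (\<lambda>\<mu>. {1..m \<mu>}))) z \<and>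
    rat_eval (sum ?s (Sigma {0..K} (\<lambda>\<mu>. {1..m \<mu>}))) z =
    (\<Sum>x\<in>Sigma {0..K} (\<lambda>\<mu>. {1..m \<mu>}). rat_eval (?s x) z)"
    by (rule rat_eval_sum) (use s in blast)
  have sm2: "(\<Sum>x\<in>Sigma {0..K} (\<lambda>\<mu>. {1..m \<mu>}). rat_eval (?s x) z) =
     (\<Sum>(\<mu>, k)\<in>Sigma {0..K} (\<lambda>\<mu>. {1..m \<mu>}).
            r \<mu> k $ i $ j * cnj ((poly (circ_num \<mu>) z / (z - p \<mu>)) ^ k))"
    using s by (intro sum.cong) auto
  note add = rat_eval_add[OF rat_eval_to_fract(1) sm[THEN conjunct1], of "[:r0 $ i $ j:]"]
  show ?thesis
    unfolding eq rat_eval_uminus(2)[OF add(1)] add(2) sm[THEN conjunct2] sm2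
    using rat_eval_uminus(1)[OF add(1)] by simp
qed

text \<open>
Reflection exchanges expansions in the two systems of basis functions: over the common denominator,
the conjugate of an expansion is the polynomial with the negated conjugate coefficients.
\<close>

lemma poly_pf_num_circle:
  fixes r0 :: "complex^'d^'d"
  assumes z: "norm z = 1" and p0: "p 0 = 0" and p: "\<forall>\<mu>\<in>{1..K}. norm (p \<mu>) < 1"
  shows "poly (pf_num {0..K} p circ_num m (- cnj (r0 $ i $ j)) (\<lambda>\<mu> k. - cnj (r \<mu> k $ i $ j))) z =
    poly (\<Prod>\<mu>\<in>{0..K}. [:- p \<mu>, 1:] ^ m \<mu>) z * cnj (rat_eval (pf_expansion K p m r0 r $ i $ j) z)"
proof -
  have nz: "z \<notin> p ` {0..K}"
  proof
    assume "z \<in> p ` {0..K}"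
    then obtain \<mu> where "\<mu> \<in> {0..K}" "z = p \<mu>" by auto
    thus False using bspec[OF p, of \<mu>] p0 z by (cases "\<mu> = 0") auto
  qed
  have ev: "cnj (rat_eval (pf_expansion K p m r0 r $ i $ j) z) =
     - cnj (r0 $ i $ j) + (\<Sum>(\<mu>, k)\<in>Sigma {0..K} (\<lambda>\<mu>. {1..m \<mu>}).
            - cnj (r \<mu> k $ i $ j) * (poly (circ_num \<mu>) z / (z - p \<mu>)) ^ k)"
  proof -
    have "rat_eval (pf_expansion K p m r0 r $ i $ j) z =
      - (r0 $ i $ j + (\<Sum>(\<mu>, k)\<in>Sigma {0..K} (\<lambda>\<mu>. {1..m \<mu>}).
            r \<mu> k $ i $ j * cnj ((poly (circ_num \<mu>) z / (z - p \<mu>)) ^ k)))"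
      using rat_eval_pf_expansion[OF z p0 p] by blast
    thus ?thesis
      by (simp add: case_prod_unfold sum_negf del: complex_cnj_power complex_cnj_divide)
  qed
  show ?thesis
    unfolding poly_pf_num[OF finite_atLeastAtMost nz] ev by (rule refl)
qed

section \<open>The inverse of the second spectral factor\<close>

theorem theorem2:
  fixes h h\<^sub>s :: "ratfun^'d^'d"
    and K :: nat
    and p :: "nat \<Rightarrow> complex"
    and m :: "nat \<Rightarrow> nat"
    and \<rho>\<^sub>0 :: "complex^'d^'d"
    and \<rho> :: "nat \<Rightarrow> nat \<Rightarrow> complex^'d^'d"
  assumes "admissible h"
    and "admissible h\<^sub>s"
    and "\<And>\<theta>::real. - pi \<le> \<theta> \<Longrightarrow> \<theta> < pi \<Longrightarrow>
           mat_eval h (cis \<theta>) ** ctranspose (mat_eval h (cis \<theta>)) =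
           ctranspose (mat_eval h\<^sub>s (cis \<theta>)) ** mat_eval h\<^sub>s (cis \<theta>)"
    and "p 0 = 0"
    and "\<And>\<mu>. \<mu> \<in> {1..K} \<Longrightarrow> norm (p \<mu>) < 1 \<and> p \<mu> \<noteq> 0"
    and "inj_on p {1..K}"
    and "\<And>\<mu>. \<mu> \<in> {1..K} \<Longrightarrow> m \<mu> \<ge> 1"
    and "matrix_inv h = pf_expansion K p m \<rho>\<^sub>0 \<rho>"
    and "\<And>\<mu>. \<mu> \<in> pf_indices K m \<Longrightarrow> \<rho> \<mu> (m \<mu>) \<noteq> 0"
  shows "\<exists>(\<rho>\<^sub>0\<^sub>s :: complex^'d^'d) (\<rho>\<^sub>s :: nat \<Rightarrow> nat \<Rightarrow> complex^'d^'d).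
           matrix_inv h\<^sub>s = pf_expansion K p m \<rho>\<^sub>0\<^sub>s \<rho>\<^sub>s \<and>
           (\<forall>\<mu> \<in> pf_indices K m. \<rho>\<^sub>s \<mu> (m \<mu>) \<noteq> 0) \<and>
           (\<forall>\<mu> \<in> pf_indices K m.
              \<rho> \<mu> (m \<mu>) ** ctranspose (mat_eval h\<^sub>s (p \<mu>)) =
              ctranspose (mat_eval h (p \<mu>)) ** \<rho>\<^sub>s \<mu> (m \<mu>))"
proof -
  define I where "I = {0..K}"
  define P where "P = (\<Prod>\<mu>\<in>I. [:- p \<mu>, 1:] ^ m \<mu>)"
  define F where "F = matrix_inv h"
  define G where "G = matrix_inv h\<^sub>s"
  define N :: "complex poly^'d^'d" where
    "N = (\<chi> i j. pf_num I p circ_num m (- cnj (\<rho>\<^sub>0 $ j $ i)) (\<lambda>\<mu> k. - cnj (\<rho> \<mu> k $ j $ i)))"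
  define N' where "N' = map_matrix to_fract N"
  define L where "L = h\<^sub>s ** N' ** F"
  have fin: "finite I" by (simp add: I_def)
  have p_lt: "norm (p \<mu>) < 1" if "\<mu> \<in> I" for \<mu>
    using that assms(4,5) by (cases "\<mu> = 0") (auto simp: I_def)
  have p_lt': "\<forall>\<mu>\<in>{1..K}. norm (p \<mu>) < 1"
    using assms(5) by simp
  have inj: "inj_on p I"
  proof -
    have "I = insert 0 {1..K}" by (auto simp: I_def)
    moreover have "p 0 \<notin> p ` ({1..K} - {0})" using assms(4,5) by fastforce
    ultimately show ?thesis using assms(6) by (simp add: inj_on_insert)
  qed
  have num_deg: "degree (circ_num \<mu>) \<le> 1" for \<mu>
    by (simp add: circ_num_def)
  have num_nz: "poly (circ_num \<mu>) (p \<mu>) \<noteq> 0" if "\<mu> \<in> I" for \<mu>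
    using that assms(5)[of \<mu>] by (auto simp: circ_num_def I_def)
  have P0: "P \<noteq> 0" and degP: "degree P = (\<Sum>\<mu>\<in>I. m \<mu>)"
    using fin by (simp_all add: P_def degree_prod_sum_eq degree_power_eq)
  have not_pole: "z \<notin> p ` I" if "norm z = 1" for z
    using p_lt that by fastforce
  have Pz: "poly P z \<noteq> 0" if "norm z = 1" for z
    using not_pole[OF that] fin by (auto simp: P_def poly_prod)

  have reg_h: "mat_regular h z" "mat_regular h\<^sub>s z"
    and det_h: "det (mat_eval h z) \<noteq> 0" "det (mat_eval h\<^sub>s z) \<noteq> 0" if "norm z \<le> 1" for z
    using assms(1,2) that by (auto simp: admissible_def mat_regular_def)
  have hF: "h ** F = mat 1" "F ** h = mat 1" and hG: "h\<^sub>s ** G = mat 1" "G ** h\<^sub>s = mat 1"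
    using mat_regular_inv[of h 0] mat_regular_inv[of h\<^sub>s 0] reg_h[of 0] det_h[of 0]
    by (simp_all add: F_def G_def)
  have reg_FG: "mat_regular F z" "mat_regular G z" if "norm z \<le> 1" for z
    using mat_regular_inv(3) reg_h[OF that] det_h[OF that] by (auto simp: F_def G_def)
  have reg_N: "mat_regular N' z" for z
    by (simp add: mat_regular_def N'_def)
  have reg_L: "mat_regular L z" "mat_eval L z = mat_eval h\<^sub>s z ** mat_eval N' z ** mat_eval F z"
    if "norm z \<le> 1" for z
    using reg_h[OF that] reg_FG[OF that] reg_N by (simp_all add: L_def mat_eval_mult)
  have ev_hF: "mat_eval h z ** mat_eval F z = mat 1" "mat_eval F z ** mat_eval h z = mat 1"
    and ev_hG: "mat_eval h\<^sub>s z ** mat_eval G z = mat 1" "mat_eval G z ** mat_eval h\<^sub>s z = mat 1"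
    if "norm z \<le> 1" for z
    using reg_h[OF that] reg_FG[OF that] hF hG
    by (metis mat_eval_mult(2) mat_eval_mat_1)+

  have N_circle: "mat_eval N' z = (\<chi> i j. poly P z * ctranspose (mat_eval F z) $ i $ j)"
    if "norm z = 1" for z
    using poly_pf_num_circle[OF that assms(4) p_lt', of m \<rho>\<^sub>0 _ _ \<rho>]
    by (simp add: vec_eq_iff N'_def N_def F_def assms(8) P_def I_def)
  have G_circle: "ctranspose (mat_eval G z) = mat_eval h\<^sub>s z ** ctranspose (mat_eval F z) ** mat_eval F z"
    if z: "norm z = 1" for z
  proof (rule ctranspose_inverse_eq)
    obtain \<theta> where "- pi \<le> \<theta>" "\<theta> < pi" "z = cis \<theta>" using circle_cis[OF z] .
    with assms(3) show "mat_eval h z ** ctranspose (mat_eval h z) =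
        ctranspose (mat_eval h\<^sub>s z) ** mat_eval h\<^sub>s z"
      by blast
  qed (use ev_hF ev_hG z in auto)
  have L_circle: "rat_eval (L $ i $ j) z = poly P z * cnj (rat_eval (G $ j $ i) z)"
    if z: "norm z = 1" for z i j
  proof -
    have "mat_eval L z = (\<chi> i j. poly P z *
       (mat_eval h\<^sub>s z ** ctranspose (mat_eval F z) ** mat_eval F z) $ i $ j)"
      using z by (simp add: reg_L N_circle vec_eq_iff matrix_matrix_mult_def sum_distrib_left
          sum_distrib_right mult_ac)
    hence "mat_eval L z $ i $ j = poly P z * ctranspose (mat_eval G z) $ i $ j"
      by (simp only: G_circle[OF z] vec_lambda_beta)
    thus ?thesis by simp
  qed
  have "\<exists>A c0 c. L $ i $ j = to_fract A \<and> A = pf_num I p circ_num m c0 c" for i j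
  proof -
    have reg: "\<And>z. norm z \<le> 1 \<Longrightarrow> \<not> rat_pole (L $ i $ j) z"
      "\<And>z. norm z \<le> 1 \<Longrightarrow> \<not> rat_pole (G $ j $ i) z"
      using reg_L(1) reg_FG(2) by (simp_all add: mat_regular_def)
    obtain A where A: "L $ i $ j = to_fract A" "degree A \<le> degree P"
      by (rule polynomial_if_reflection_regular[OF reg L_circle P0])
    obtain c0 c where c: "\<And>z. z \<notin> p ` I \<Longrightarrow> poly A z / poly P z =
      c0 + (\<Sum>(i, j)\<in>Sigma I (\<lambda>i. {1..m i}). c i j * (poly (circ_num i) z / (z - p i)) ^ j)"
      using partial_fractions[OF fin inj num_deg num_nz A(2)[unfolded degP]]
      unfolding P_def by blast
    have "A = pf_num I p circ_num m c0 c"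
    proof (rule poly_eqI_infinite[OF infinite_circle])
      fix z :: complex assume "z \<in> {z. norm z = 1}"
      hence z: "norm z = 1" by simp
      show "poly A z = poly (pf_num I p circ_num m c0 c) z"
        unfolding poly_pf_num[OF fin not_pole[OF z]] P_def[symmetric] c[OF not_pole[OF z], symmetric]
        using Pz[OF z] by simp
    qed
    thus ?thesis using A(1) by blast
  qed
  then obtain c0 c where L_eq:
    "\<And>i j. L $ i $ j = to_fract (pf_num I p circ_num m (c0 i j) (c i j))"
    by metis
  \<comment> \<open>On the circle \<open>L / P\<close> is the conjugate transpose of \<open>G\<close>, and expansions carry a global minus sign.\<close>
  define \<rho>\<^sub>0\<^sub>s :: "complex^'d^'d" where "\<rho>\<^sub>0\<^sub>s = (\<chi> i j. - cnj (c0 j i))"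
  define \<rho>\<^sub>s :: "nat \<Rightarrow> nat \<Rightarrow> complex^'d^'d" where "\<rho>\<^sub>s \<mu> k = (\<chi> i j. - cnj (c j i \<mu> k))" for \<mu> k

  have "G = pf_expansion K p m \<rho>\<^sub>0\<^sub>s \<rho>\<^sub>s"
  proof -
    have "G $ i $ j = pf_expansion K p m \<rho>\<^sub>0\<^sub>s \<rho>\<^sub>s $ i $ j" for i j
    proof (rule ratfun_eqI[OF infinite_circle])
      fix z :: complex assume "z \<in> {z. norm z = 1}"
      hence z: "norm z = 1" by simp
      have "poly P z * cnj (rat_eval (pf_expansion K p m \<rho>\<^sub>0\<^sub>s \<rho>\<^sub>s $ i $ j) z) =
        poly (pf_num I p circ_num m (c0 j i) (c j i)) z"
        using poly_pf_num_circle[OF z assms(4) p_lt', of m \<rho>\<^sub>0\<^sub>s i j \<rho>\<^sub>s]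
        by (simp add: \<rho>\<^sub>0\<^sub>s_def \<rho>\<^sub>s_def P_def I_def)
      also have "\<dots> = rat_eval (L $ j $ i) z"
        by (simp add: L_eq)
      also have "\<dots> = poly P z * cnj (rat_eval (G $ i $ j) z)"
        by (rule L_circle[OF z])
      finally have "rat_eval (G $ i $ j) z = rat_eval (pf_expansion K p m \<rho>\<^sub>0\<^sub>s \<rho>\<^sub>s $ i $ j) z"
        using Pz[OF z] by simp
      thus "\<not> rat_pole (G $ i $ j) z \<and> \<not> rat_pole (pf_expansion K p m \<rho>\<^sub>0\<^sub>s \<rho>\<^sub>s $ i $ j) z \<and>
        rat_eval (G $ i $ j) z = rat_eval (pf_expansion K p m \<rho>\<^sub>0\<^sub>s \<rho>\<^sub>s $ i $ j) z"
        using reg_FG(2)[of z] z conjunct1[OF rat_eval_pf_expansion[OF z assms(4) p_lt']]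
        by (simp add: mat_regular_def)
    qed
    thus ?thesis by (simp add: vec_eq_iff)
  qed
  moreover have rel: "\<rho> \<mu> (m \<mu>) ** ctranspose (mat_eval h\<^sub>s (p \<mu>)) =
              ctranspose (mat_eval h (p \<mu>)) ** \<rho>\<^sub>s \<mu> (m \<mu>)" if "\<mu> \<in> pf_indices K m" for \<mu>
  proof -
    have \<mu>: "\<mu> \<in> I" "m \<mu> \<ge> 1"
      using that assms(7)[of \<mu>] by (cases "\<mu> = 0"; simp add: pf_indices_def I_def)+
    define w where "w = p \<mu>"
    \<comment> \<open>The factor in \<open>poly_pf_num_pole\<close>, common to \<open>L\<close> and \<open>N\<close>.\<close>
    define \<kappa> where "\<kappa> = poly (circ_num \<mu>) w ^ m \<mu> * (\<Prod>k\<in>I - {\<mu>}. (w - p k) ^ m k)"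
    have w: "norm w \<le> 1" using p_lt[OF \<mu>(1)] by (simp add: w_def)
    have "w - p k \<noteq> 0" if "k \<in> I - {\<mu>}" for k
      using that inj \<mu>(1) by (auto simp: w_def inj_on_def)
    hence \<kappa>: "\<kappa> \<noteq> 0"
      using num_nz[OF \<mu>(1)] fin by (simp add: \<kappa>_def w_def)
    have lead: "poly (pf_num I p circ_num m a0 a) w = a \<mu> (m \<mu>) * \<kappa>" for a0 a
      unfolding w_def \<kappa>_def by (intro poly_pf_num_pole fin inj \<mu>)
    have "mat_eval L w ** mat_eval h w = mat_eval h\<^sub>s w ** mat_eval N' w"
      using ev_hF(2)[OF w] by (simp add: reg_L(2)[OF w] matrix_mul_assoc[symmetric])
    moreover have "mat_eval L w = (\<chi> i j. - \<kappa> * ctranspose (\<rho>\<^sub>s \<mu> (m \<mu>)) $ i $ j)"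
      by (simp add: vec_eq_iff L_eq lead \<rho>\<^sub>s_def)
    moreover have "mat_eval N' w = (\<chi> i j. - \<kappa> * ctranspose (\<rho> \<mu> (m \<mu>)) $ i $ j)"
      by (simp add: vec_eq_iff N'_def N_def lead)
    ultimately have *: "(\<chi> i j. - \<kappa> * ctranspose (\<rho>\<^sub>s \<mu> (m \<mu>)) $ i $ j) ** mat_eval h w =
       mat_eval h\<^sub>s w ** (\<chi> i j. - \<kappa> * ctranspose (\<rho> \<mu> (m \<mu>)) $ i $ j)"
      by simp
    have "ctranspose (\<rho>\<^sub>s \<mu> (m \<mu>)) ** mat_eval h w = mat_eval h\<^sub>s w ** ctranspose (\<rho> \<mu> (m \<mu>))"
    proof -
      have l: "(\<chi> i j. - \<kappa> * X $ i $ j) ** Y = (\<chi> i j. - \<kappa> * (X ** Y) $ i $ j)"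
        and r: "Y ** (\<chi> i j. - \<kappa> * X $ i $ j) = (\<chi> i j. - \<kappa> * (Y ** X) $ i $ j)"
        for X Y :: "complex^'d^'d"
        by (simp_all add: vec_eq_iff matrix_matrix_mult_def sum_distrib_left mult_ac)
      show ?thesis
        using * \<kappa> unfolding l r by (simp add: vec_eq_iff)
    qed
    from arg_cong[OF this, of ctranspose] show ?thesis
      by (simp add: ctranspose_mult w_def)
  qed
  moreover have "\<rho>\<^sub>s \<mu> (m \<mu>) \<noteq> 0" if \<mu>: "\<mu> \<in> pf_indices K m" for \<mu>
  proof
    assume "\<rho>\<^sub>s \<mu> (m \<mu>) = 0"
    hence 0: "\<rho> \<mu> (m \<mu>) ** ctranspose (mat_eval h\<^sub>s (p \<mu>)) = 0"
      using rel[OF \<mu>] by (simp add: matrix_matrix_mult_def vec_eq_iff)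
    have "norm (p \<mu>) \<le> 1"
      using p_lt[of \<mu>] \<mu> by (simp add: pf_indices_def I_def)
    hence 1: "ctranspose (mat_eval h\<^sub>s (p \<mu>)) ** ctranspose (mat_eval G (p \<mu>)) = mat 1"
      using ev_hG by (simp add: ctranspose_mult[symmetric] ctranspose_mat_1)
    have "\<rho> \<mu> (m \<mu>) = \<rho> \<mu> (m \<mu>) ** ctranspose (mat_eval h\<^sub>s (p \<mu>)) ** ctranspose (mat_eval G (p \<mu>))"
      by (simp add: matrix_mul_assoc[symmetric] 1)
    also have "\<dots> = 0"
      unfolding 0 by (simp add: matrix_matrix_mult_def vec_eq_iff)
    finally show False using assms(9)[OF \<mu>] by simp
  qed
  ultimately show ?thesis
    unfolding G_def by blast
qed

end
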